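(* Let $m$ and $n$ be non-negative integers and let $v$ be a real number. If $n$ is even, then $$\sum_{k=0}^n (-1)^k\binom nk 2^{-k-m}\binom{2k+2m+v}{(2k+2m+v)/2}\binom{k+m+v}{v/2}^{-1}=\sum_{k=0}^{\lfloor m/2\rfloor}\binom m{2k}2^{-n-2k}\binom{2k+n}{(2k+n)/2}\binom{(2k+n+v)/2}{(2k+n)/2}^{-1},$$ and if $n$ is odd, then $$\sum_{k=0}^n (-1)^k\binom nk 2^{-k-m}\binom{2k+2m+v}{(2k+2m+v)/2}\binom{k+m+v}{v/2}^{-1}=-\sum_{k=1}^{\lceil m/2\rceil}\binom m{2k-1}2^{-n-2k+1}\binom{2k+n-1}{(2k+n-1)/2}\binom{(2k+n-1+v)/2}{(2k+n-1)/2}^{-1}.$$ In particular (case $v=0$), $$\sum_{k=0}^n (-1)^k\binom nk 2^{-k-m}\binom{2(k+m)}{k+m}=\begin{cases}\displaystyle\sum_{k=0}^{\lfloor m/2\rfloor}\binom m{2k}2^{-n-2k}\binom{2k+n}{(2k+n)/2}, & n\text{ even},\\[2mm] \displaystyle-\sum_{k=1}^{\lceil m/2\rceil}\binom m{2k-1}2^{-n-2k+1}\binom{2k+n-1}{(2k+n-1)/2}, & n\text{ odd}.\end{cases}$$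
   Context: For non-negative integers the binomial coefficients are the usual ones (zero when the lower index exceeds the upper). Generalized binomial coefficients are defined for complex numbers $a,b$, excluding the set of negative integers, by $\binom ab=\frac{\Gamma(a+1)}{\Gamma(b+1)\Gamma(a-b+1)}$; the identity is read for those real $v$ for which the binomial coefficients in it are so defined. The notation $\binom ab^{-1}$ means the reciprocal $1/\binom ab$. Empty sums are $0$. *)

theory Defs
  imports "HOL-Analysis.Analysis"
begin

definition neg_Ints :: "'a :: ring_1 set" where
  "neg_Ints = {of_int i | i. i < 0}"

text \<open>
  Binomial coefficients with arbitrary upper and lower index; the library's \<open>gchoose\<close> has a
  natural number as its lower index. The class \<open>Gamma\<close> comprises the reals and the complex numbers.
  If \<open>a\<close> and \<open>b\<close> are not negative integers but \<open>a - b\<close> is one, then \<open>Gamma (a - b + 1) = 0\<close> in the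
  library, and the value is \<open>0\<close>, in accordance with \<open>1 / Gamma\<close> vanishing at the poles of Gamma.
\<close>

definition gen_binomial :: "'a :: Gamma \<Rightarrow> 'a \<Rightarrow> 'a" where
  "gen_binomial a b = Gamma (a + 1) / (Gamma (b + 1) * Gamma (a - b + 1))"

definition gen_binomial_defined :: "'a :: Gamma \<Rightarrow> 'a \<Rightarrow> bool" where
  "gen_binomial_defined a b \<longleftrightarrow> a \<notin> neg_Ints \<and> b \<notin> neg_Ints"

lemma gen_binomial_of_nat:
  "gen_binomial (of_nat n) (of_nat k) = (of_nat (n choose k) :: 'a :: Gamma)"
proof (cases "k \<le> n")
  case True
  have "Gamma (of_nat j + 1 :: 'a) = fact j" for j
    using Gamma_fact[of j, where ?'a = 'a] by (simp add: add.commute)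
  from this[of n] this[of k] this[of "n - k"] True show ?thesis
    by (simp add: gen_binomial_def binomial_fact of_nat_diff)
next
  case False
  then have "of_nat n - of_nat k + 1 = (- of_nat (k - n - 1) :: 'a)"
    by (simp add: of_nat_diff)
  then have "of_nat n - of_nat k + 1 \<in> (\<int>\<^sub>\<le>\<^sub>0 :: 'a set)"
    by simp
  then have "Gamma (of_nat n - of_nat k + 1 :: 'a) = 0"
    by (simp add: Gamma_eq_zero_iff)
  with False show ?thesis
    by (simp add: gen_binomial_def)
qed

lemma gen_binomial_complex_of_real:
  "gen_binomial (complex_of_real a) (complex_of_real b) = complex_of_real (gen_binomial a b)"
  using Gamma_complex_of_real[of "a + 1"] Gamma_complex_of_real[of "b + 1"]
    Gamma_complex_of_real[of "a - b + 1"]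
  by (simp add: gen_binomial_def)

end

theory Submission
  imports Defs
begin

text \<open>
  For \<open>v > -1\<close> let \<open>E\<close> be the expectation for the probability density on \<open>[-1, 1]\<close> proportional to
  \<open>(1 - t\<^sup>2) powr ((v - 1) / 2)\<close>. The left-hand summands contain \<open>E ((1 + t) ^ (k + m))\<close>, and the
  right-hand ones contain the even moments \<open>E (t ^ (2 * i))\<close>, while the odd moments vanish. So both
  sides are \<open>E ((1 + t) ^ m * (- t) ^ n)\<close>. For general \<open>v\<close> no integral is needed: \<open>E\<close> is the
  linear functional on polynomials given by its moments, and integration by parts,
  \<open>E ((1 - t\<^sup>2) * q') = (v + 1) * E (t * q)\<close>, becomes the recurrence of the moments. Taking
  \<open>q = (1 + t) ^ j\<close> yields \<open>(j + v + 1) * E ((1 + t) ^ (j + 1)) = (2 * j + v + 1) * E ((1 + t) ^ j)\<close>,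
  which the Gamma quotients on the left satisfy too.
\<close>

section \<open>Binomial transforms of a sequence\<close>

text \<open>If \<open>f\<close> is a moment sequence of \<open>E\<close>, then \<open>binomial_sum f m n\<close> is \<open>E ((1 + t) ^ m * t ^ n)\<close>.\<close>

definition binomial_sum :: "(nat \<Rightarrow> 'a :: comm_ring_1) \<Rightarrow> nat \<Rightarrow> nat \<Rightarrow> 'a" where
  "binomial_sum f m n = (\<Sum>i\<le>m. of_nat (m choose i) * f (n + i))"

lemma binomial_sum_0 [simp]: "binomial_sum f 0 n = f n"
  by (simp add: binomial_sum_def)

lemma binomial_sum_Suc:
  "binomial_sum f (Suc m) n = binomial_sum f m n + binomial_sum f m (Suc n)"
proof -
  have "binomial_sum f (Suc m) n = f n + (\<Sum>i\<le>m. of_nat (Suc m choose Suc i) * f (Suc (n + i)))"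
    unfolding binomial_sum_def by (subst sum.atMost_Suc_shift) simp
  also have "\<dots> = (f n + (\<Sum>i\<le>m. of_nat (m choose Suc i) * f (n + Suc i))) + binomial_sum f m (Suc n)"
    by (simp add: binomial_sum_def sum.distrib algebra_simps)
  also have "f n + (\<Sum>i\<le>m. of_nat (m choose Suc i) * f (n + Suc i))
      = (\<Sum>i\<le>Suc m. of_nat (m choose i) * f (n + i))"
    unfolding sum.atMost_Suc_shift by simp
  also have "\<dots> = binomial_sum f m n"
    by (simp add: binomial_sum_def binomial_eq_0)
  finally show ?thesis .
qed

text \<open>Expanding the factor \<open>1 - (1 + t) = - t\<close> of
  \<open>(1 - (1 + t)) ^ n * (- (1 + t)) ^ m\<close> in powers of \<open>1 + t\<close> gives the
  left side. The induction step uses Pascal's rule on both sides, so \<open>m\<close> must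
  vary.\<close>

lemma binomial_sum_alternating:
  "binomial_sum (\<lambda>j. (-1) ^ j * binomial_sum f j 0) n m = (-1) ^ (m + n) * binomial_sum f m n"
proof (induction n arbitrary: m)
  case (Suc n)
  show ?case
    by (simp add: binomial_sum_Suc Suc.IH algebra_simps)
qed simp

text \<open>This evaluates the left side of the theorem once its summands contain
  \<open>E ((1 + t) ^ (k + m))\<close>; the shift by \<open>m\<close> contributes a sign that
  cancels the \<open>(-1) ^ m\<close> of the preceding lemma.\<close>

lemma sum_binomial_sum_alternating:
  "(\<Sum>k=0..n. (-1) ^ k * of_nat (n choose k) * binomial_sum f (k + m) 0)
    = (-1) ^ n * binomial_sum f m n"
proof -
  have "(\<Sum>k=0..n. (-1) ^ k * of_nat (n choose k) * binomial_sum f (k + m) 0)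
      = (-1) ^ m * binomial_sum (\<lambda>j. (-1) ^ j * binomial_sum f j 0) n m"
    unfolding binomial_sum_def[of _ n m] sum_distrib_left atLeast0AtMost
    by (intro sum.cong refl) (simp add: power_add add.commute mult_ac)
  also have "\<dots> = ((-1) ^ m * (-1) ^ m) * (-1) ^ n * binomial_sum f m n"
    by (simp add: binomial_sum_alternating power_add mult.assoc)
  finally show ?thesis
    by (simp flip: power_mult_distrib)
qed

section \<open>Sums over one parity, negative integers, integer powers\<close>

lemma sum_even_support:
  fixes f :: "nat \<Rightarrow> 'a :: comm_monoid_add"
  assumes "\<And>i. odd i \<Longrightarrow> f i = 0"
  shows "(\<Sum>i\<le>m. f i) = (\<Sum>k=0..m div 2. f (2 * k))"
proof -
  have "(\<Sum>i\<le>m. f i) = (\<Sum>i | i \<le> m \<and> even i. f i)"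
    by (rule sum.mono_neutral_right) (auto simp: assms)
  also have "\<dots> = (\<Sum>k=0..m div 2. f (2 * k))"
    by (rule sum.reindex_bij_witness[where i = "\<lambda>k. 2 * k" and j = "\<lambda>i. i div 2"])
       (auto)
  finally show ?thesis .
qed

text \<open>\<open>(m + 1) div 2\<close> is the ceiling of \<open>m / 2\<close>, and starting at
  \<open>k = 1\<close> keeps the truncated subtraction in \<open>2 * k - 1\<close> exact.\<close>

lemma sum_odd_support:
  fixes f :: "nat \<Rightarrow> 'a :: comm_monoid_add"
  assumes "\<And>i. even i \<Longrightarrow> f i = 0"
  shows "(\<Sum>i\<le>m. f i) = (\<Sum>k=1..(m + 1) div 2. f (2 * k - 1))"
proof -
  have "(\<Sum>i\<le>m. f i) = (\<Sum>i | i \<le> m \<and> odd i. f i)"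
    by (rule sum.mono_neutral_right) (auto simp: assms)
  also have "\<dots> = (\<Sum>k=1..(m + 1) div 2. f (2 * k - 1))"
    by (rule sum.reindex_bij_witness[where i = "\<lambda>k. 2 * k - 1" and j = "\<lambda>i. (i + 1) div 2"])
       (auto elim!: oddE)
  finally show ?thesis .
qed

lemma plus_one_nonpos_Ints_iff: "x + 1 \<in> \<int>\<^sub>\<le>\<^sub>0 \<longleftrightarrow> x \<in> neg_Ints" for x :: real
proof
  assume "x + 1 \<in> \<int>\<^sub>\<le>\<^sub>0"
  then obtain i where "x + 1 = of_int i" "i \<le> 0"
    by (auto elim: nonpos_Ints_cases)
  then have "x = of_int (i - 1)" "i - 1 < 0"
    by auto
  then show "x \<in> neg_Ints"
    unfolding neg_Ints_def by blast
next
  assume "x \<in> neg_Ints"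
  then obtain i where "x = of_int i" "i < 0"
    by (auto simp: neg_Ints_def)
  then have "x + 1 = of_int (i + 1)" "i + 1 \<le> 0"
    by auto
  then show "x + 1 \<in> \<int>\<^sub>\<le>\<^sub>0"
    by (metis nonpos_Ints_of_int)
qed

lemma power_int_eq_minus_nat: "z = - int p \<Longrightarrow> x powi z = 1 / x ^ p" for x :: "'a :: field"
  by (simp add: power_int_minus inverse_eq_divide)

section \<open>Moments of the symmetric beta density\<close>

text \<open>The moment \<open>E (t ^ i)\<close>, in the factors of the right-hand summands. For
  \<open>i = 2 * p\<close> and \<open>v > -1\<close> it is the quotient of the rising factorials of
  \<open>1 / 2\<close> and \<open>v / 2 + 1\<close> of length \<open>p\<close>.\<close>

definition sym_beta_moment :: "real \<Rightarrow> nat \<Rightarrow> real" where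
  "sym_beta_moment v i = (if even i
     then real (i choose (i div 2)) / 2 ^ i
       * inverse (gen_binomial ((real i + v) / 2) (real i / 2)) else 0)"

text \<open>For \<open>v > -1\<close> the variable \<open>(1 + t) / 2\<close> is Beta distributed
  with both parameters \<open>(v + 1) / 2\<close>, and this is \<open>E ((1 + t) ^ j)\<close>. At
  \<open>j = k + m\<close> it is the left-hand summand without \<open>(-1) ^ k\<close> and
  \<open>n choose k\<close>.\<close>

definition beta_moment :: "real \<Rightarrow> nat \<Rightarrow> real" where
  "beta_moment v j = gen_binomial (2 * real j + v) ((2 * real j + v) / 2)
     * inverse (gen_binomial (real j + v) (v / 2)) / 2 ^ j"

text \<open>The reciprocal Gamma function is entire, so this form suits both the recurrence and the
  limit in \<open>v\<close>.\<close>

lemma sym_beta_moment_double: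
  "sym_beta_moment v (2 * p) = fact (2 * p) / (fact p * 4 ^ p) * Gamma (v / 2 + 1)
     * rGamma (real p + v / 2 + 1)"
proof -
  have "gen_binomial ((real (2 * p) + v) / 2) (real (2 * p) / 2)
      = gen_binomial (real p + v / 2) (real p)"
    by (intro arg_cong2[where f = gen_binomial]) simp_all
  then have "sym_beta_moment v (2 * p)
      = real (2 * p choose p) / 4 ^ p * inverse (gen_binomial (real p + v / 2) (real p))"
    unfolding sym_beta_moment_def by (simp only:) (simp add: power_mult)
  also have "real (2 * p choose p) = fact (2 * p) / (fact p * fact p)"
    by (simp add: binomial_fact mult_2)
  also have "gen_binomial (real p + v / 2) (real p)
      = Gamma (real p + v / 2 + 1) / (fact p * Gamma (v / 2 + 1))"
    using Gamma_fact[of p, where ?'a = real] by (simp add: gen_binomial_def add.commute)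
  also have "fact (2 * p) / (fact p * fact p) / 4 ^ p
        * inverse (Gamma (real p + v / 2 + 1) / (fact p * Gamma (v / 2 + 1)))
      = fact (2 * p) / (fact p * 4 ^ p) * Gamma (v / 2 + 1) * rGamma (real p + v / 2 + 1)"
  proof -
    \<comment> \<open>The cases \<open>x = 0\<close> and \<open>y = 0\<close> are included because
      \<open>inverse 0 = 0\<close>; they cover the poles of Gamma.\<close>
    have "a / (f * f) / c * inverse (x / (f * y)) = a / (f * c) * y * inverse x"
      if "f \<noteq> 0" for a c f x y :: real
      using that by (simp add: divide_simps)
    then show ?thesis
      by (simp only: rGamma_inverse_Gamma fact_nonzero not_False_eq_True)
  qed
  finally show ?thesis .
qed

lemma sym_beta_moment_odd: "odd i \<Longrightarrow> sym_beta_moment v i = 0"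
  by (simp add: sym_beta_moment_def)

lemma sym_beta_moment_0:
  assumes "v / 2 \<notin> neg_Ints"
  shows "sym_beta_moment v 0 = 1"
  using sym_beta_moment_double[of v 0] assms
  by (simp add: rGamma_inverse_Gamma Gamma_eq_zero_iff plus_one_nonpos_Ints_iff)

text \<open>Integration by parts with \<open>q = t ^ (i + 1)\<close>. For even \<open>i\<close> it
  comes from the functional equation of \<open>rGamma\<close>, used without division, and the ratio
  \<open>p + 1 / 2\<close> of consecutive factorial quotients.\<close>

lemma sym_beta_moment_rec:
  assumes "v / 2 \<notin> neg_Ints"
  shows "(real i + v + 2) * sym_beta_moment v (i + 2) = real (i + 1) * sym_beta_moment v i"
proof (cases "even i")
  case True
  then obtain p where i: "i = 2 * p" ..
  have "i + 2 = 2 * Suc p"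
    by (simp add: i)
  moreover define R where "R = rGamma (real (Suc p) + v / 2 + 1)"
  moreover define c where "c = (fact (2 * p) / (fact p * 4 ^ p) :: real)"
  moreover have "rGamma (real p + v / 2 + 1) = (real p + v / 2 + 1) * R"
    using rGamma_plus1[of "real p + v / 2 + 1"] by (simp add: R_def add_ac)
  moreover have "fact (2 * Suc p) / (fact (Suc p) * 4 ^ Suc p)
      = (real p + 1 / 2) * c"
  proof -
    have "fact (2 * Suc p) = (2 * (2 * real p + 1)) * ((real p + 1) * fact (2 * p))"
      by (simp add: algebra_simps)
    moreover have "fact (Suc p) * 4 ^ Suc p = (real p + 1) * (4 * (fact p * 4 ^ p) :: real)"
      by (simp add: algebra_simps)
    moreover have "2 * (2 * x + 1) * ((x + 1) * a) / ((x + 1) * (4 * b)) = (x + 1 / 2) * (a / b)"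
      if "x + 1 \<noteq> 0" for x a b :: real
      using that by (simp add: divide_simps)
    ultimately show ?thesis
      unfolding c_def by (simp only: not_False_eq_True)
  qed
  ultimately have "sym_beta_moment v (i + 2) = (real p + 1 / 2) * c * Gamma (v / 2 + 1) * R"
      "sym_beta_moment v i = c * Gamma (v / 2 + 1) * ((real p + v / 2 + 1) * R)"
    by (simp_all only: i sym_beta_moment_double)
  then show ?thesis
    by (simp only:) (simp add: i field_simps)
qed (simp add: sym_beta_moment_odd)

section \<open>Recurrence for the moments of \<open>1 + t\<close>\<close>

text \<open>Integration by parts with \<open>q = (1 + t) ^ j\<close>, where
  \<open>(1 - t\<^sup>2) * q' = j * (1 - t) * (1 + t) ^ j\<close>, carried out monomial by
  monomial.\<close>

lemma binomial_sum_sym_beta_moment_1: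
  assumes "v / 2 \<notin> neg_Ints"
  shows "(real j + v + 1) * binomial_sum (sym_beta_moment v) j 1
    = real j * binomial_sum (sym_beta_moment v) j 0"
proof (cases j)
  case 0
  then show ?thesis
    by (simp add: sym_beta_moment_odd)
next
  case (Suc l)
  let ?M = "sym_beta_moment v" and ?B = "binomial_sum (sym_beta_moment v)"
  \<comment> \<open>The numbers \<open>i * (j choose i)\<close> are the coefficients of
    \<open>t * q'\<close>.\<close>
  have absorb: "(\<Sum>i\<le>j. real i * real (j choose i) * g i)
      = real j * (\<Sum>i\<le>l. real (l choose i) * g (Suc i))" for g
  proof -
    have "(\<Sum>i\<le>j. real i * real (j choose i) * g i)
        = (\<Sum>i\<le>l. real (Suc i * (Suc l choose Suc i)) * g (Suc i))"
      unfolding Suc by (subst sum.atMost_Suc_shift) (simp del: binomial_Suc_Suc add: algebra_simps)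
    also have "\<dots> = real j * (\<Sum>i\<le>l. real (l choose i) * g (Suc i))"
      unfolding Suc_times_binomial sum_distrib_left Suc by (simp only: of_nat_mult mult.assoc)
    finally show ?thesis .
  qed
  \<comment> \<open>At \<open>i = 0\<close> the truncated \<open>i - 1\<close> is multiplied by 0,
    and the first moment on the left vanishes.\<close>
  have rec: "(real i + v + 1) * ?M (i + 1) = real i * ?M (i - 1)" for i
  proof (cases i)
    case 0
    then show ?thesis by (simp add: sym_beta_moment_odd)
  next
    case (Suc l)
    then show ?thesis
      using sym_beta_moment_rec[OF assms, of l] by (simp add: add_ac)
  qed
  have "(v + 1) * ?B j 1 + real j * ?B l 2
      = (v + 1) * ?B j 1 + (\<Sum>i\<le>j. real i * real (j choose i) * ?M (i + 1))"
    unfolding absorb by (simp add: binomial_sum_def)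
  also have "\<dots> = (\<Sum>i\<le>j. real (j choose i) * ((real i + v + 1) * ?M (i + 1)))"
    unfolding binomial_sum_def sum_distrib_left sum.distrib[symmetric]
    by (intro sum.cong refl) (simp add: algebra_simps)
  also have "\<dots> = (\<Sum>i\<le>j. real i * real (j choose i) * ?M (i - 1))"
    unfolding rec by (simp add: mult_ac)
  also have "\<dots> = real j * ?B l 0"
    unfolding absorb by (simp add: binomial_sum_def)
  finally have "(v + 1) * ?B j 1 + real j * ?B l 2 = real j * ?B l 0" .
  \<comment> \<open>These give \<open>?B l 0 - ?B l 2 = ?B j 0 - ?B j 1\<close>, that is,
    \<open>(1 - t\<^sup>2) * (1 + t) ^ l = (1 - t) * (1 + t) ^ j\<close> under
    \<open>E\<close>.\<close>
  moreover have "?B j 1 = ?B l 1 + ?B l 2" "?B j 0 = ?B l 0 + ?B l 1"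
    by (simp_all add: Suc binomial_sum_Suc numeral_2_eq_2)
  ultimately show ?thesis
    by (simp add: algebra_simps)
qed

lemma binomial_sum_sym_beta_moment_rec:
  assumes "v / 2 \<notin> neg_Ints"
  shows "(real j + v + 1) * binomial_sum (sym_beta_moment v) (Suc j) 0
    = (2 * real j + v + 1) * binomial_sum (sym_beta_moment v) j 0"
  using binomial_sum_sym_beta_moment_1[OF assms, of j]
  by (simp add: binomial_sum_Suc algebra_simps)

section \<open>The Gamma quotients on the left\<close>

text \<open>One of the two equal Gamma factors in the denominator of the central coefficient cancels
  against the other coefficient; the hypothesis makes it nonzero.\<close>

lemma beta_moment_Gamma:
  assumes "real j + v / 2 \<notin> neg_Ints"
  shows "beta_moment v j = Gamma (2 * real j + v + 1) * Gamma (v / 2 + 1)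
    * rGamma (real j + v / 2 + 1) * rGamma (real j + v + 1) / 2 ^ j"
proof -
  have "Gamma (real j + v / 2 + 1) \<noteq> 0"
    using assms by (simp add: Gamma_eq_zero_iff plus_one_nonpos_Ints_iff)
  moreover have "(2 * real j + v) / 2 = real j + v / 2" "2 * real j + v - (real j + v / 2) = real j + v / 2"
    "real j + v - v / 2 = real j + v / 2"
    by simp_all
  ultimately show ?thesis
    unfolding beta_moment_def gen_binomial_def by (simp add: rGamma_inverse_Gamma field_simps)
qed

text \<open>Both sides are 1 at \<open>j = 0\<close> and satisfy the same first-order recurrence. A
  non-integer \<open>v\<close> keeps the Gamma arguments off the poles and the leading coefficient
  \<open>real j + v + 1\<close> nonzero.\<close>

lemma beta_moment_nonint:
  assumes "v \<notin> \<int>"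
  shows "beta_moment v j = binomial_sum (sym_beta_moment v) j 0"
proof -
  have Ints: "neg_Ints \<subseteq> (\<int> :: real set)"
    by (auto simp: neg_Ints_def)
  have half: "v / 2 \<notin> \<int>"
  proof
    assume "v / 2 \<in> \<int>"
    then have "2 * (v / 2) \<in> \<int>"
      by (intro Ints_mult) auto
    with assms show False by simp
  qed
  have shift: "x + real k \<notin> \<int>" if "x \<notin> \<int>" for x k
    using that by (metis Ints_diff Ints_of_nat add_diff_cancel_right')
  have neg: "v / 2 \<notin> neg_Ints"
    using half Ints by blast
  show ?thesis
  proof (induction j)
    case 0
    have "v + 1 \<notin> \<int>\<^sub>\<le>\<^sub>0" "v / 2 + 1 \<notin> \<int>\<^sub>\<le>\<^sub>0"
      using assms half Ints unfolding plus_one_nonpos_Ints_iff by blast+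
    then have "Gamma (v + 1) \<noteq> 0" "Gamma (v / 2 + 1) \<noteq> 0"
      by (simp_all only: Gamma_eq_zero_iff not_False_eq_True)
    then show ?case
      using neg by (simp add: beta_moment_Gamma sym_beta_moment_0 rGamma_inverse_Gamma flip: divide_inverse)
  next
    case (Suc j)
    have nonneg: "real k + v / 2 \<notin> neg_Ints" for k
      using shift[OF half, of k] Ints by (auto simp: add.commute)
    have "2 * real j + v + 1 \<notin> \<int>" "2 * real j + v + 2 \<notin> \<int>"
      using shift[OF assms, of "2 * j + 1"] shift[OF assms, of "2 * j + 2"]
      by (simp_all add: algebra_simps)
    then have "2 * real j + v + 1 \<notin> \<int>\<^sub>\<le>\<^sub>0" "2 * real j + v + 2 \<notin> \<int>\<^sub>\<le>\<^sub>0"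
      by auto
    then have G: "Gamma (2 * real (Suc j) + v + 1)
        = (2 * real j + v + 2) * ((2 * real j + v + 1) * Gamma (2 * real j + v + 1))"
      using Gamma_plus1[of "2 * real j + v + 1"] Gamma_plus1[of "2 * real j + v + 2"]
      by (simp add: add_ac)
    have r: "rGamma (real j + v / 2 + 1)
          = (real j + v / 2 + 1) * rGamma (real (Suc j) + v / 2 + 1)"
        "rGamma (real j + v + 1) = (real j + v + 1) * rGamma (real (Suc j) + v + 1)"
      using rGamma_plus1[of "real j + v / 2 + 1"] rGamma_plus1[of "real j + v + 1"]
      by (simp_all add: add_ac)
    \<comment> \<open>The factor \<open>2 * real j + v + 2\<close> cancels against
      \<open>real j + v / 2 + 1\<close> and the extra 2 in \<open>2 ^ Suc j\<close>.\<close>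
    have "(real j + v + 1) * beta_moment v (Suc j) = (2 * real j + v + 1) * beta_moment v j"
      unfolding beta_moment_Gamma[OF nonneg] G r by (simp add: field_simps)
    also have "\<dots> = (real j + v + 1) * binomial_sum (sym_beta_moment v) (Suc j) 0"
      by (simp add: Suc.IH binomial_sum_sym_beta_moment_rec[OF neg])
    finally have "(real j + v + 1) * beta_moment v (Suc j)
        = (real j + v + 1) * binomial_sum (sym_beta_moment v) (Suc j) 0" .
    moreover have "real j + v + 1 \<noteq> 0"
    proof
      assume "real j + v + 1 = 0"
      then have "v + real (j + 1) = 0"
        by simp
      with shift[OF assms, of "j + 1"] show False
        by (simp only: Ints_0 not_True_eq_False)
    qed
    ultimately show ?case
      by (simp only: mult_cancel_left) simp
  qed
qed

text \<open>
  The recurrence degenerates at odd negative \<open>v\<close>, where some of the \<open>beta_moment v j\<close>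
  are undefined but those occurring in the theorem need not be; such \<open>v\<close> are reached by continuity.
\<close>

lemma beta_moment_eq_binomial_sum:
  assumes "2 * real j + v \<notin> neg_Ints" "real j + v / 2 \<notin> neg_Ints" "v / 2 \<notin> neg_Ints"
  shows "beta_moment v j = binomial_sum (sym_beta_moment v) j 0"
proof -
  have nonpos: "2 * real j + v + 1 \<notin> \<int>\<^sub>\<le>\<^sub>0" "v / 2 + 1 \<notin> \<int>\<^sub>\<le>\<^sub>0"
    using assms by (simp_all add: plus_one_nonpos_Ints_iff)
  \<comment> \<open>Isolation of the integers lets the limit run through values covered by
    \<open>beta_moment_nonint\<close>.\<close>
  have ev: "eventually (\<lambda>w. w \<notin> \<int>) (at v)"
  proof (cases "v \<in> \<int>")
    case True
    then obtain i where i: "v = of_int i"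
      by (auto elim: Ints_cases)
    have "w \<notin> \<int>" if w: "w \<in> {v - 1<..<v + 1}" "w \<noteq> v" for w
    proof
      assume "w \<in> \<int>"
      then obtain l where l: "w = of_int l"
        by (auto elim: Ints_cases)
      from w(1) have "i - 1 < l" "l < i + 1"
        unfolding i l by (simp_all flip: of_int_less_iff[where ?'a = real])
      with w(2) show False
        by (simp add: i l)
    qed
    then show ?thesis
      unfolding eventually_at_topological by (intro exI[of _ "{v - 1<..<v + 1}"]) auto
  next
    case False
    then show ?thesis
      unfolding eventually_at_topological
      by (intro exI[of _ "- \<int>"]) (auto simp: open_Compl)
  qed
  let ?f = "\<lambda>w. Gamma (2 * real j + w + 1) * Gamma (w / 2 + 1)
    * rGamma (real j + w / 2 + 1) * rGamma (real j + w + 1) / 2 ^ j"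
  \<comment> \<open>By \<open>nonpos\<close> neither Gamma factor has a pole at \<open>v\<close>;
    the \<open>rGamma\<close> factors are continuous everywhere, even where
    \<open>real j + v + 1\<close> is a pole of Gamma.\<close>
  have "(?f \<longlongrightarrow> ?f v) (at v)"
    using nonpos
    by (intro tendsto_intros isCont_tendsto_compose[OF isCont_rGamma[OF continuous_ident]]) auto
  then have "(?f \<longlongrightarrow> beta_moment v j) (at v)"
    using beta_moment_Gamma assms by simp
  moreover have "eventually (\<lambda>w. ?f w = binomial_sum (sym_beta_moment w) j 0) (at v)"
    using ev
  proof eventually_elim
    case (elim w)
    have "real j + w / 2 \<notin> neg_Ints"
    proof
      assume "real j + w / 2 \<in> neg_Ints"
      then obtain i where "real j + w / 2 = of_int i"
        by (auto simp: neg_Ints_def)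
      then have "w = of_int (2 * (i - int j))"
        by simp
      with elim show False
        using Ints_of_int by blast
    qed
    then show ?case
      using beta_moment_nonint[OF elim, of j] beta_moment_Gamma[of j w] by simp
  qed
  ultimately have "((\<lambda>w. binomial_sum (sym_beta_moment w) j 0) \<longlongrightarrow> beta_moment v j) (at v)"
    by (rule Lim_transform_eventually)
  moreover have "((\<lambda>w. sym_beta_moment w i) \<longlongrightarrow> sym_beta_moment v i) (at v)" for i
  proof (cases "even i")
    case True
    then obtain p where i: "i = 2 * p" ..
    show ?thesis
      unfolding i sym_beta_moment_double using nonpos
        by (intro tendsto_intros isCont_tendsto_compose[OF isCont_rGamma[OF continuous_ident]]) auto
  qed (simp add: sym_beta_moment_odd)
  then have "((\<lambda>w. binomial_sum (sym_beta_moment w) j 0) \<longlongrightarrow> binomial_sum (sym_beta_moment v) j 0) (at v)"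
    unfolding binomial_sum_def by (intro tendsto_intros)
  ultimately show ?thesis
    by (intro tendsto_unique[of "at v"]) auto
qed

section \<open>Evaluation of both sides\<close>

text \<open>Each left-hand summand contains \<open>beta_moment v (k + m)\<close>, so the sum is
  \<open>E ((1 + t) ^ m * (- t) ^ n)\<close>, here expanded in moments of \<open>t\<close>.\<close>

lemma sum_beta_moment:
  fixes m n :: nat and v :: real
  assumes "\<forall>k\<in>{0..n}.
      gen_binomial_defined (2 * real k + 2 * real m + v) ((2 * real k + 2 * real m + v) / 2) \<and>
      gen_binomial_defined (real k + real m + v) (v / 2)"
  shows "(\<Sum>k=0..n. (-1) ^ k * real (n choose k) * 2 powi (- int k - int m)
        * gen_binomial (2 * real k + 2 * real m + v) ((2 * real k + 2 * real m + v) / 2)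
        * inverse (gen_binomial (real k + real m + v) (v / 2)))
    = (-1) ^ n * (\<Sum>i\<le>m. real (m choose i) * sym_beta_moment v (n + i))" (is "?lhs = _")
proof -
  have "(-1) ^ k * real (n choose k) * 2 powi (- int k - int m)
        * gen_binomial (2 * real k + 2 * real m + v) ((2 * real k + 2 * real m + v) / 2)
        * inverse (gen_binomial (real k + real m + v) (v / 2))
      = (-1) ^ k * real (n choose k) * binomial_sum (sym_beta_moment v) (k + m) 0"
    if "k \<in> {0..n}" for k
  proof -
    have "2 powi (- int k - int m) = (1 / 2 ^ (k + m) :: real)"
      by (rule power_int_eq_minus_nat) simp
    moreover have "beta_moment v (k + m) = binomial_sum (sym_beta_moment v) (k + m) 0"
      using assms that
      by (intro beta_moment_eq_binomial_sum) (auto simp: gen_binomial_defined_def add_divide_distrib algebra_simps)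
    moreover have "2 powi (- int k - int m)
        * (gen_binomial (2 * real k + 2 * real m + v) ((2 * real k + 2 * real m + v) / 2)
        * inverse (gen_binomial (real k + real m + v) (v / 2))) = beta_moment v (k + m)"
      unfolding calculation(1) by (simp add: beta_moment_def algebra_simps)
    ultimately show ?thesis
      by (simp only: mult.assoc)
  qed
  then have "?lhs = (\<Sum>k=0..n. (-1) ^ k * real (n choose k) * binomial_sum (sym_beta_moment v) (k + m) 0)"
    by (rule sum.cong[OF refl])
  then show ?thesis
    by (simp add: sum_binomial_sum_alternating binomial_sum_def[of _ m n])
qed

theorem theorem2:
  fixes m n :: nat and v :: real
  shows
    "(even n \<and>
      (\<forall>k\<in>{0..n}.
        gen_binomial_defined (2 * real k + 2 * real m + v) ((2 * real k + 2 * real m + v) / 2) \<and>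
        gen_binomial_defined (real k + real m + v) (v / 2)) \<and>
      (\<forall>k\<in>{0..m div 2}.
        gen_binomial_defined ((2 * real k + real n + v) / 2) ((2 * real k + real n) / 2))
      \<longrightarrow>
      (\<Sum>k=0..n. (-1) ^ k * real (n choose k) * 2 powi (- int k - int m)
          * gen_binomial (2 * real k + 2 * real m + v) ((2 * real k + 2 * real m + v) / 2)
          * inverse (gen_binomial (real k + real m + v) (v / 2)))
      = (\<Sum>k=0..m div 2. real (m choose (2 * k)) * 2 powi (- int n - 2 * int k)
          * real ((2 * k + n) choose ((2 * k + n) div 2))
          * inverse (gen_binomial ((2 * real k + real n + v) / 2) ((2 * real k + real n) / 2))))
    \<and>
     (odd n \<and>
      (\<forall>k\<in>{0..n}.
        gen_binomial_defined (2 * real k + 2 * real m + v) ((2 * real k + 2 * real m + v) / 2) \<and>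
        gen_binomial_defined (real k + real m + v) (v / 2)) \<and>
      (\<forall>k\<in>{1..(m + 1) div 2}.
        gen_binomial_defined ((2 * real k + real n - 1 + v) / 2) ((2 * real k + real n - 1) / 2))
      \<longrightarrow>
      (\<Sum>k=0..n. (-1) ^ k * real (n choose k) * 2 powi (- int k - int m)
          * gen_binomial (2 * real k + 2 * real m + v) ((2 * real k + 2 * real m + v) / 2)
          * inverse (gen_binomial (real k + real m + v) (v / 2)))
      = - (\<Sum>k=1..(m + 1) div 2. real (m choose (2 * k - 1)) * 2 powi (- int n - 2 * int k + 1)
          * real ((2 * k + n - 1) choose ((2 * k + n - 1) div 2))
          * inverse (gen_binomial ((2 * real k + real n - 1 + v) / 2) ((2 * real k + real n - 1) / 2))))
    \<and>
     (\<Sum>k=0..n. (-1) ^ k * real (n choose k) * 2 powi (- int k - int m)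
          * real ((2 * (k + m)) choose (k + m)))
      = (if even n
         then (\<Sum>k=0..m div 2. real (m choose (2 * k)) * 2 powi (- int n - 2 * int k)
                * real ((2 * k + n) choose ((2 * k + n) div 2)))
         else - (\<Sum>k=1..(m + 1) div 2. real (m choose (2 * k - 1)) * 2 powi (- int n - 2 * int k + 1)
                * real ((2 * k + n - 1) choose ((2 * k + n - 1) div 2))))"
proof -
  let ?L = "\<lambda>v. \<Sum>k=0..n. (-1) ^ k * real (n choose k) * 2 powi (- int k - int m)
          * gen_binomial (2 * real k + 2 * real m + v) ((2 * real k + 2 * real m + v) / 2)
          * inverse (gen_binomial (real k + real m + v) (v / 2))"
  let ?E = "\<lambda>v. \<Sum>k=0..m div 2. real (m choose (2 * k)) * 2 powi (- int n - 2 * int k)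
          * real ((2 * k + n) choose ((2 * k + n) div 2))
          * inverse (gen_binomial ((2 * real k + real n + v) / 2) ((2 * real k + real n) / 2))"
  let ?O = "\<lambda>v. \<Sum>k=1..(m + 1) div 2. real (m choose (2 * k - 1)) * 2 powi (- int n - 2 * int k + 1)
          * real ((2 * k + n - 1) choose ((2 * k + n - 1) div 2))
          * inverse (gen_binomial ((2 * real k + real n - 1 + v) / 2) ((2 * real k + real n - 1) / 2))"
  let ?D = "\<lambda>v. \<forall>k\<in>{0..n}.
        gen_binomial_defined (2 * real k + 2 * real m + v) ((2 * real k + 2 * real m + v) / 2) \<and>
        gen_binomial_defined (real k + real m + v) (v / 2)"
  \<comment> \<open>For even \<open>n\<close> the index \<open>n + i\<close> is even exactly for
    even \<open>i\<close>, so only \<open>i = 2 * k\<close> contributes.\<close>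
  have even_case: "?L v = ?E v" if "even n" "?D v" for v
  proof -
    have "?L v = (\<Sum>i\<le>m. real (m choose i) * sym_beta_moment v (n + i))"
      using sum_beta_moment[OF \<open>?D v\<close>] \<open>even n\<close> by simp
    also have "\<dots> = (\<Sum>k=0..m div 2. real (m choose (2 * k)) * sym_beta_moment v (n + 2 * k))"
      by (rule sum_even_support) (simp add: sym_beta_moment_odd \<open>even n\<close>)
    also have "\<dots> = ?E v"
    proof (intro sum.cong refl)
      fix k
      have "2 powi (- int n - 2 * int k) = (1 / 2 ^ (n + 2 * k) :: real)"
        by (rule power_int_eq_minus_nat) simp
      then show "real (m choose (2 * k)) * sym_beta_moment v (n + 2 * k)
          = real (m choose (2 * k)) * 2 powi (- int n - 2 * int k)
          * real ((2 * k + n) choose ((2 * k + n) div 2))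
          * inverse (gen_binomial ((2 * real k + real n + v) / 2) ((2 * real k + real n) / 2))"
        using \<open>even n\<close> by (simp add: sym_beta_moment_def add_ac)
    qed
    finally show ?thesis .
  qed
  \<comment> \<open>For odd \<open>n\<close> only \<open>i = 2 * k - 1\<close> contributes, and
    \<open>(-1) ^ n\<close> is the outer minus sign.\<close>
  have odd_case: "?L v = - ?O v" if "odd n" "?D v" for v
  proof -
    have "?L v = - (\<Sum>i\<le>m. real (m choose i) * sym_beta_moment v (n + i))"
      using sum_beta_moment[OF \<open>?D v\<close>] \<open>odd n\<close> by simp
    also have "(\<Sum>i\<le>m. real (m choose i) * sym_beta_moment v (n + i))
        = (\<Sum>k=1..(m + 1) div 2. real (m choose (2 * k - 1)) * sym_beta_moment v (n + (2 * k - 1)))"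
      by (rule sum_odd_support) (simp add: sym_beta_moment_odd \<open>odd n\<close>)
    also have "\<dots> = ?O v"
    proof (intro sum.cong refl)
      fix k assume "k \<in> {1..(m + 1) div 2}"
      \<comment> \<open>Here \<open>k \<ge> 1\<close>, so the natural-number subtractions are
        exact.\<close>
      then have k: "n + (2 * k - 1) = 2 * k + n - 1"
        and real_k: "real (2 * k + n - 1) = 2 * real k + real n - 1"
        by (auto simp: of_nat_diff)
      have "2 powi (- int n - 2 * int k + 1) = (1 / 2 ^ (2 * k + n - 1) :: real)"
      using \<open>k \<in> _\<close> by (intro power_int_eq_minus_nat) auto
      moreover have "even (2 * k + n - 1)"
        using \<open>odd n\<close> by simp
      ultimately show "real (m choose (2 * k - 1)) * sym_beta_moment v (n + (2 * k - 1))
          = real (m choose (2 * k - 1)) * 2 powi (- int n - 2 * int k + 1)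
          * real ((2 * k + n - 1) choose ((2 * k + n - 1) div 2))
          * inverse (gen_binomial ((2 * real k + real n - 1 + v) / 2) ((2 * real k + real n - 1) / 2))"
        unfolding k sym_beta_moment_def real_k by simp
    qed
    finally show ?thesis .
  qed
  have D0: "?D 0"
    by (auto simp: gen_binomial_defined_def neg_Ints_def)
  \<comment> \<open>At \<open>v = 0\<close> the inverted coefficients have lower index 0 or equal to
    the upper one, so all of them are 1.\<close>
  have self: "gen_binomial (real p) (real p) = 1" for p
    using gen_binomial_of_nat[of p p, where ?'a = real] by simp
  have zero: "gen_binomial (real p) 0 = 1" for p
    using gen_binomial_of_nat[of p 0, where ?'a = real] by simp
  have L0: "?L 0 = (\<Sum>k=0..n. (-1) ^ k * real (n choose k) * 2 powi (- int k - int m)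
          * real ((2 * (k + m)) choose (k + m)))"
  proof (intro sum.cong refl)
    fix k
    show "(-1) ^ k * real (n choose k) * 2 powi (- int k - int m)
          * gen_binomial (2 * real k + 2 * real m + 0) ((2 * real k + 2 * real m + 0) / 2)
          * inverse (gen_binomial (real k + real m + 0) (0 / 2))
        = (-1) ^ k * real (n choose k) * 2 powi (- int k - int m)
          * real ((2 * (k + m)) choose (k + m))"
      using zero[of "k + m"] gen_binomial_of_nat[of "2 * (k + m)" "k + m", where ?'a = real]
      by (simp add: add_divide_distrib)
  qed
  have E0: "?E 0 = (\<Sum>k=0..m div 2. real (m choose (2 * k)) * 2 powi (- int n - 2 * int k)
                * real ((2 * k + n) choose ((2 * k + n) div 2)))" if "even n"
  proof (intro sum.cong refl)
    fix k
    have "(2 * real k + real n) / 2 = real (k + n div 2)"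
      using that by auto
    then show "real (m choose (2 * k)) * 2 powi (- int n - 2 * int k)
          * real ((2 * k + n) choose ((2 * k + n) div 2))
          * inverse (gen_binomial ((2 * real k + real n + 0) / 2) ((2 * real k + real n) / 2))
        = real (m choose (2 * k)) * 2 powi (- int n - 2 * int k)
          * real ((2 * k + n) choose ((2 * k + n) div 2))"
      by (simp only: add_0_right self) simp
  qed
  have O0: "?O 0 = (\<Sum>k=1..(m + 1) div 2. real (m choose (2 * k - 1)) * 2 powi (- int n - 2 * int k + 1)
                * real ((2 * k + n - 1) choose ((2 * k + n - 1) div 2)))" if "odd n"
  proof (intro sum.cong refl)
    fix k
    have "(2 * real k + real n - 1) / 2 = real (k + (n - 1) div 2)"
      using that by (auto elim!: oddE)
    then show "real (m choose (2 * k - 1)) * 2 powi (- int n - 2 * int k + 1)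
          * real ((2 * k + n - 1) choose ((2 * k + n - 1) div 2))
          * inverse (gen_binomial ((2 * real k + real n - 1 + 0) / 2) ((2 * real k + real n - 1) / 2))
        = real (m choose (2 * k - 1)) * 2 powi (- int n - 2 * int k + 1)
          * real ((2 * k + n - 1) choose ((2 * k + n - 1) div 2))"
      by (simp only: add_0_right self) simp
  qed
  show ?thesis
  proof (intro conjI impI, goal_cases)
    case 1
    then show ?case
      by (elim conjE) (rule even_case)
  next
    case 2
    then show ?case
      by (elim conjE) (rule odd_case)
  next
    case 3
    show ?case
    proof (cases "even n")
      case True
      then show ?thesis
        using even_case[OF True D0] unfolding L0 E0[OF True] by (simp only: if_True)
    next
      case False
      then show ?thesis
        using odd_case[OF False D0] unfolding L0 O0[OF False] by (simp only: if_False)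
    qed
  qed
qed

end
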